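(* Let $Q_{4n}=\langle r,s\mid r^{2n}=1,\ s^2=r^n,\ s^{-1}rs=r^{-1}\rangle$ be the generalized quaternion group of order $4n$. Let $d_1,\dots,d_t$ be the distinct proper divisors of $2n$ (divisors $d$ with $1<d<2n$) that are different from $2$. Then the power graph of $Q_{4n}$ can be expressed as the joined union (generalized join) $$\mathcal{P}(Q_{4n})=\mathscr{G}[K_1,K_1,K_{\phi(2n)},K_{\phi(d_1)},K_{\phi(d_2)},\dots,K_{\phi(d_t)},\underbrace{K_2,K_2,\dots,K_2}_{n}],$$ where the parent graph $\mathscr{G}$ has vertex set $V(\mathscr{G})=\{v_1,v_2,v_3\}\cup\{w_i\}_{i=1}^{t}\cup\{y_k\}_{k=1}^{n}$ (in the order corresponding to the listed graphs) with adjacency relations: $v_1\sim u$ for all $u\in V(\mathscr{G})\setminus\{v_1\}$; $v_2\sim v_3$; $v_2\sim y_k$ for all $1\le k\le n$; $v_2\sim w_i$ if $2\mid d_i$; $w_i\sim w_j$ (for $i\ne j$) if $d_i\mid d_j$ or $d_j\mid d_i$; and $v_3\sim w_i$ for all $1\le i\le t$.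
   Context: For a finite group $\mathcal{G}$, the power graph $\mathcal{P}(\mathcal{G})$ is the simple graph with vertex set $\mathcal{G}$ in which two distinct elements are adjacent if one is a positive power of the other. $\phi$ is Euler's totient function and $K_m$ is the complete graph on $m$ vertices. For a graph $\mathscr{G}$ with vertices $u_1,\dots,u_m$, the joined union $\mathscr{G}[\mathscr{G}_1,\dots,\mathscr{G}_m]$ is obtained from the disjoint union of $\mathscr{G}_1,\dots,\mathscr{G}_m$ by joining every vertex of $\mathscr{G}_i$ to every vertex of $\mathscr{G}_j$ whenever $u_i\sim u_j$ in $\mathscr{G}$.
   Formalization: The formal theorem assumes n ≥ 2, the usual convention for generalized quaternion groups; for n = 1 the presentation gives the cyclic group of order 4, while the joined union would have 5 vertices, so the claim fails there. *)

theory Defs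
  imports
    "HOL-Algebra.Group"
    "HOL-Number_Theory.Totient"
    "Graph_Theory.Graph_Theory"
begin

section \<open>Groups given by generators and relations\<close>

text \<open>
  A word over the generators (all elements of the type \<open>'g\<close>) and their formal inverses:
  \<open>(x, True)\<close> is the letter \<open>x\<close> and \<open>(x, False)\<close> is the letter \<open>x\<^sup>-\<^sup>1\<close>.
\<close>
type_synonym 'g word = "('g \<times> bool) list"

text \<open>
  The congruence on words generated by free cancellation and the relations \<open>u = v\<close>
  for \<open>(u, v) \<in> E\<close>. Its quotient is the free group modulo the normal closure of all \<open>u v\<^sup>-\<^sup>1\<close>.
\<close>
inductive pres_eq :: "('g word \<times> 'g word) set \<Rightarrow> 'g word \<Rightarrow> 'g word \<Rightarrow> bool"
  for E :: "('g word \<times> 'g word) set" where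
  relation: "(u, v) \<in> E \<Longrightarrow> pres_eq E u v"
| cancel: "pres_eq E [(x, b), (x, \<not> b)] []"
| refl: "pres_eq E u u"
| sym: "pres_eq E u v \<Longrightarrow> pres_eq E v u"
| trans: "pres_eq E u v \<Longrightarrow> pres_eq E v w \<Longrightarrow> pres_eq E u w"
| append: "pres_eq E u u' \<Longrightarrow> pres_eq E v v' \<Longrightarrow> pres_eq E (u @ v) (u' @ v')"

definition pres_class :: "('g word \<times> 'g word) set \<Rightarrow> 'g word \<Rightarrow> 'g word set" where
  "pres_class E u = {v. pres_eq E u v}"

text \<open>The union in the multiplication is a union of equal sets, see \<open>mult_presented_group\<close>.\<close>
definition presented_group :: "('g word \<times> 'g word) set \<Rightarrow> 'g word set monoid" where
  "presented_group E =
     \<lparr> carrier = range (pres_class E),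
       monoid.mult = (\<lambda>A B. \<Union>a\<in>A. \<Union>b\<in>B. pres_class E (a @ b)),
       one = pres_class E [] \<rparr>"

lemma pres_class_eq_iff: "pres_class E u = pres_class E v \<longleftrightarrow> pres_eq E u v"
  unfolding pres_class_def by (blast intro: pres_eq.refl pres_eq.sym pres_eq.trans)

lemma mult_presented_group:
  "pres_class E u \<otimes>\<^bsub>presented_group E\<^esub> pres_class E v = pres_class E (u @ v)"
proof -
  have "pres_class E (a @ b) = pres_class E (u @ v)"
    if "a \<in> pres_class E u" "b \<in> pres_class E v" for a b
    using that unfolding pres_class_eq_iff
    by (simp add: pres_class_def pres_eq.sym pres_eq.append)
  then have "(\<Union>a\<in>pres_class E u. \<Union>b\<in>pres_class E v. pres_class E (a @ b)) =
      (\<Union>a\<in>pres_class E u. \<Union>b\<in>pres_class E v. pres_class E (u @ v))"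
    by (intro SUP_cong HOL.refl)
  also have "(\<Union>a\<in>pres_class E u. \<Union>b\<in>pres_class E v. pres_class E (u @ v)) =
      pres_class E (u @ v)"
  proof -
    have "u \<in> pres_class E u" "v \<in> pres_class E v"
      by (simp_all add: pres_class_def pres_eq.refl)
    then show ?thesis by blast
  qed
  finally show ?thesis
    by (simp add: presented_group_def)
qed

lemma pres_eq_inverse: "pres_eq E (map (\<lambda>(x, b). (x, \<not> b)) (rev u) @ u) []"
proof (induction u)
  case Nil
  show ?case by (simp add: pres_eq.refl)
next
  case (Cons a u)
  obtain x b where a: "a = (x, b)" by (cases a)
  let ?u' = "map (\<lambda>(x, b). (x, \<not> b)) (rev u)"
  have "pres_eq E [(x, \<not> b), (x, b)] []"
    using pres_eq.cancel[of E x "\<not> b"] by simp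
  then have "pres_eq E (?u' @ ([(x, \<not> b), (x, b)] @ u)) (?u' @ ([] @ u))"
    by (rule pres_eq.append[OF pres_eq.refl pres_eq.append[OF _ pres_eq.refl]])
  then have "pres_eq E (?u' @ ([(x, \<not> b), (x, b)] @ u)) []"
    using Cons.IH by (simp add: pres_eq.trans[of E _ "?u' @ u"])
  then show ?case
    by (simp add: a)
qed

lemma group_presented_group: "group (presented_group E)"
proof (rule groupI)
  fix X assume "X \<in> carrier (presented_group E)"
  then obtain u where X: "X = pres_class E u" by (auto simp: presented_group_def)
  let ?Y = "pres_class E (map (\<lambda>(x, b). (x, \<not> b)) (rev u))"
  have "?Y \<otimes>\<^bsub>presented_group E\<^esub> X = pres_class E []"
    unfolding X mult_presented_group pres_class_eq_iff by (rule pres_eq_inverse)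
  moreover have "?Y \<in> carrier (presented_group E)"
    "\<one>\<^bsub>presented_group E\<^esub> = pres_class E []"
    by (simp_all add: presented_group_def)
  ultimately show "\<exists>Y\<in>carrier (presented_group E).
      Y \<otimes>\<^bsub>presented_group E\<^esub> X = \<one>\<^bsub>presented_group E\<^esub>"
    by auto
next
  have carrier: "carrier (presented_group E) = range (pres_class E)"
    and one: "\<one>\<^bsub>presented_group E\<^esub> = pres_class E []"
    by (simp_all add: presented_group_def)
  show "\<one>\<^bsub>presented_group E\<^esub> \<in> carrier (presented_group E)"
    by (simp add: carrier one)
  show "X \<otimes>\<^bsub>presented_group E\<^esub> Y \<in> carrier (presented_group E)"
    if "X \<in> carrier (presented_group E)" "Y \<in> carrier (presented_group E)" for X Y
    using that by (auto simp: carrier mult_presented_group)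
  show "X \<otimes>\<^bsub>presented_group E\<^esub> Y \<otimes>\<^bsub>presented_group E\<^esub> Z =
        X \<otimes>\<^bsub>presented_group E\<^esub> (Y \<otimes>\<^bsub>presented_group E\<^esub> Z)"
    if "X \<in> carrier (presented_group E)" "Y \<in> carrier (presented_group E)"
       "Z \<in> carrier (presented_group E)" for X Y Z
    using that by (auto simp: carrier mult_presented_group)
  show "\<one>\<^bsub>presented_group E\<^esub> \<otimes>\<^bsub>presented_group E\<^esub> X = X"
    if "X \<in> carrier (presented_group E)" for X
    using that by (auto simp: carrier one mult_presented_group)
qed

section \<open>The generalized quaternion group\<close>

datatype quat_gen = gen_r | gen_s

definition quat_rels :: "nat \<Rightarrow> (quat_gen word \<times> quat_gen word) set" where
  "quat_rels n =
     {(replicate (2 * n) (gen_r, True), []),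
      ([(gen_s, True), (gen_s, True)], replicate n (gen_r, True)),
      ([(gen_s, False), (gen_r, True), (gen_s, True)], [(gen_r, False)])}"

definition quaternion_group :: "nat \<Rightarrow> quat_gen word set monoid" where
  "quaternion_group n = presented_group (quat_rels n)"

section \<open>Graphs\<close>

text \<open>
  A simple graph is a symmetric loop-free digraph on pairs (locale \<open>pair_graph\<close>):
  an edge between \<open>x\<close> and \<open>y\<close> is the pair of arcs \<open>(x, y)\<close>, \<open>(y, x)\<close>.
\<close>

definition power_graph :: "('a, 'b) monoid_scheme \<Rightarrow> 'a pair_pre_digraph" where
  "power_graph G =
     \<lparr> pverts = carrier G,
       parcs = {(x, y). x \<in> carrier G \<and> y \<in> carrier G \<and> x \<noteq> y \<and>
                  (\<exists>k::nat. k > 0 \<and> (y = x [^]\<^bsub>G\<^esub> k \<or> x = y [^]\<^bsub>G\<^esub> k))} \<rparr>"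

definition complete_graph :: "nat \<Rightarrow> nat pair_pre_digraph" where
  "complete_graph m = \<lparr> pverts = {..<m}, parcs = {(x, y). x < m \<and> y < m \<and> x \<noteq> y} \<rparr>"

lemma complete_digraph_complete_graph: "complete_digraph m (with_proj (complete_graph m))"
  unfolding complete_digraph_pair_def by (auto simp: complete_graph_def)

text \<open>
  The graphs to be joined are indexed by the vertices of the parent graph \<open>P\<close>;
  the vertex \<open>(i, x)\<close> is the copy of the vertex \<open>x\<close> of \<open>F i\<close> in the disjoint union.
\<close>
definition joined_union ::
  "'i pair_pre_digraph \<Rightarrow> ('i \<Rightarrow> 'a pair_pre_digraph) \<Rightarrow> ('i \<times> 'a) pair_pre_digraph" where
  "joined_union P F =
     \<lparr> pverts = (SIGMA i : pverts P. pverts (F i)),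
       parcs = {((i, x), (i, y)) | i x y. i \<in> pverts P \<and> (x, y) \<in> parcs (F i)} \<union>
               {((i, x), (j, y)) | i j x y.
                  (i, j) \<in> parcs P \<and> x \<in> pverts (F i) \<and> y \<in> pverts (F j)} \<rparr>"

section \<open>The parent graph and the graphs joined along it\<close>

datatype parent_vertex = V1 | V2 | V3 | W nat | Y nat

definition parent_verts :: "nat \<Rightarrow> nat \<Rightarrow> parent_vertex set" where
  "parent_verts n t = {V1, V2, V3} \<union> W ` {1..t} \<union> Y ` {1..n}"

text \<open>Each adjacency in one orientation; \<open>parent_graph\<close> takes the symmetric closure.\<close>
definition parent_adj :: "nat \<Rightarrow> nat \<Rightarrow> (nat \<Rightarrow> nat) \<Rightarrow> parent_vertex rel" where
  "parent_adj n t d =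
     {(V1, u) | u. u \<in> parent_verts n t - {V1}} \<union>
     {(V2, V3)} \<union>
     {(V2, Y k) | k. k \<in> {1..n}} \<union>
     {(V2, W i) | i. i \<in> {1..t} \<and> 2 dvd d i} \<union>
     {(W i, W j) | i j. i \<in> {1..t} \<and> j \<in> {1..t} \<and> i \<noteq> j \<and> (d i dvd d j \<or> d j dvd d i)} \<union>
     {(V3, W i) | i. i \<in> {1..t}}"

definition parent_graph :: "nat \<Rightarrow> nat \<Rightarrow> (nat \<Rightarrow> nat) \<Rightarrow> parent_vertex pair_pre_digraph" where
  "parent_graph n t d =
     \<lparr> pverts = parent_verts n t, parcs = parent_adj n t d \<union> (parent_adj n t d)\<inverse> \<rparr>"

fun parent_block :: "nat \<Rightarrow> (nat \<Rightarrow> nat) \<Rightarrow> parent_vertex \<Rightarrow> nat pair_pre_digraph" where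
  "parent_block n d V1 = complete_graph 1"
| "parent_block n d V2 = complete_graph 1"
| "parent_block n d V3 = complete_graph (totient (2 * n))"
| "parent_block n d (W i) = complete_graph (totient (d i))"
| "parent_block n d (Y k) = complete_graph 2"

end

theory Submission
  imports Defs
begin

text \<open>
  Every element of \<open>Q\<^bsub>4n\<^esub>\<close> is uniquely \<open>r\<^sup>i\<close> or \<open>r\<^sup>i s\<close> with \<open>0 < i \<le> 2n\<close>. Two powers of \<open>r\<close>
  are adjacent iff the order of one divides the order of the other, so the elements of equal
  order \<open>k\<close> in \<open>\<langle>r\<rangle>\<close> form a clique on \<open>\<phi>(k)\<close> vertices, and these cliques are joined along
  the divisibility relation on the divisors of \<open>2n\<close>. Since \<open>(r\<^sup>i s)\<^sup>2 = r\<^sup>n\<close>, the powers of \<open>r\<^sup>i s\<close> are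
  \<open>1\<close>, \<open>r\<^sup>n\<close>, \<open>r\<^sup>i s\<close> and \<open>r\<^bsup>i+n\<^esup> s\<close>: outside \<open>\<langle>r\<rangle>\<close> the graph consists of \<open>n\<close> cliques of size \<open>2\<close>,
  each joined exactly to the elements \<open>1\<close> and \<open>r\<^sup>n\<close>, those whose order divides \<open>2\<close>.
\<close>

section \<open>Recognizing joined unions of complete graphs\<close>

text \<open>Enumerating both vertex sets by one index set \<open>I\<close> lets arcs be compared in
  coordinates. The isomorphism is \<open>h\<close> after the inverse of \<open>g\<close>; it maps
  arcs componentwise, since a pair digraph identifies an arc with its two ends.\<close>

lemma digraph_iso_with_projI:
  assumes g: "bij_betw g I (pverts G)" and h: "bij_betw h I (pverts H)"
    and G: "parcs G \<subseteq> pverts G \<times> pverts G" and H: "parcs H \<subseteq> pverts H \<times> pverts H"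
    and arcs: "\<And>p q. p \<in> I \<Longrightarrow> q \<in> I \<Longrightarrow> (g p, g q) \<in> parcs G \<longleftrightarrow> (h p, h q) \<in> parcs H"
  shows "digraph_iso (with_proj G) (with_proj H)"
proof -
  define f where "f = h \<circ> the_inv_into I g"
  have fg: "f (g p) = h p" if "p \<in> I" for p
    using that g by (simp add: f_def the_inv_into_f_f bij_betw_def)
  have f: "bij_betw f (pverts G) (pverts H)"
    unfolding f_def using g h by (blast intro: bij_betw_trans bij_betw_the_inv_into)
  have arcs_f: "(x, y) \<in> parcs G \<longleftrightarrow> (f x, f y) \<in> parcs H"
    if "x \<in> pverts G" "y \<in> pverts G" for x y
  proof -
    have "x \<in> g ` I" "y \<in> g ` I"
      using that bij_betw_imp_surj_on[OF g] by simp_all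
    then obtain p q where "p \<in> I" "q \<in> I" "x = g p" "y = g q" by (elim imageE)
    then show ?thesis by (simp add: arcs fg)
  qed
  have "map_prod f f ` parcs G = parcs H"
  proof (intro equalityI subsetI)
    fix a assume "a \<in> map_prod f f ` parcs G"
    then show "a \<in> parcs H" using G arcs_f by auto
  next
    fix a assume a: "a \<in> parcs H"
    then have "fst a \<in> f ` pverts G" "snd a \<in> f ` pverts G"
      using H bij_betw_imp_surj_on[OF f] by auto
    then obtain x y where "a = (f x, f y)" "x \<in> pverts G" "y \<in> pverts G"
      by (elim imageE) (metis prod.collapse)
    then show "a \<in> map_prod f f ` parcs G"
      using a arcs_f by (auto intro!: rev_image_eqI[of "(x, y)"])
  qed
  moreover have "inj_on (map_prod f f) (parcs G)"
    using map_prod_inj_on[of f "pverts G" f "pverts G"] f G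
    by (auto simp: bij_betw_def intro: inj_on_subset)
  moreover have "wf_digraph (with_proj G)"
    using G by unfold_locales auto
  ultimately show ?thesis
    using f unfolding digraph_iso_def
    by (intro exI[of _ "\<lparr>iso_verts = f, iso_arcs = map_prod f f, iso_head = snd, iso_tail = fst\<rparr>"])
      (auto simp: pre_digraph.digraph_isomorphism_def app_iso_def with_proj_def bij_betw_def)
qed

lemma in_parcs_joined_union:
  "((u, x), (v, y)) \<in> parcs (joined_union P F) \<longleftrightarrow>
    u = v \<and> u \<in> pverts P \<and> (x, y) \<in> parcs (F u) \<or>
    (u, v) \<in> parcs P \<and> x \<in> pverts (F u) \<and> y \<in> pverts (F v)"
  by (auto simp: joined_union_def)

text \<open>Here \<open>b\<close> sends an index to its block. A complete graph is determined by its
  size, so any numbering of each fibre of \<open>b\<close> gives the second coordinate in the joined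
  union.\<close>

lemma digraph_iso_joined_union_complete:
  assumes g: "bij_betw g I (pverts G)" and fin: "finite I"
    and G: "parcs G \<subseteq> pverts G \<times> pverts G" and P: "parcs P \<subseteq> pverts P \<times> pverts P"
    and irrefl: "\<And>u. (u, u) \<notin> parcs P"
    and b: "b ` I \<subseteq> pverts P"
    and F: "\<And>u. u \<in> pverts P \<Longrightarrow> F u = complete_graph (card {p \<in> I. b p = u})"
    and arcs: "\<And>p q. p \<in> I \<Longrightarrow> q \<in> I \<Longrightarrow>
      (g p, g q) \<in> parcs G \<longleftrightarrow> p \<noteq> q \<and> (b p = b q \<or> (b p, b q) \<in> parcs P)"
  shows "digraph_iso (with_proj G) (with_proj (joined_union P F))"
proof -
  have "\<exists>h. bij_betw h {p \<in> I. b p = u} {..<card {p \<in> I. b p = u}}" for u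
    using fin ex_bij_betw_finite_nat[of "{p \<in> I. b p = u}"] by (simp add: atLeast0LessThan)
  then obtain h where h: "bij_betw (h u) {p \<in> I. b p = u} {..<card {p \<in> I. b p = u}}" for u
    by metis
  have hF: "bij_betw (h u) {p \<in> I. b p = u} (pverts (F u))" if "u \<in> pverts P" for u
    using h[of u] F[OF that] by (simp add: complete_graph_def)
  have h_in: "h (b p) p \<in> pverts (F (b p))" if "p \<in> I" for p
    using hF[of "b p"] b that by (auto simp: bij_betw_def)
  have h_eq: "h u p = h u q \<longleftrightarrow> p = q" if "p \<in> I" "q \<in> I" "b p = u" "b q = u" for p q u
    using h[of u] that by (auto simp: bij_betw_def inj_on_def)
  have FF: "(x, y) \<in> parcs (F u) \<longleftrightarrow> x \<in> pverts (F u) \<and> y \<in> pverts (F u) \<and> x \<noteq> y"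
    if "u \<in> pverts P" for u x y
    using F[OF that] by (auto simp: complete_graph_def)
  show ?thesis
  proof (rule digraph_iso_with_projI[OF g _ G, where h = "\<lambda>p. (b p, h (b p) p)"])
    show "bij_betw (\<lambda>p. (b p, h (b p) p)) I (pverts (joined_union P F))"
    proof (intro bij_betw_imageI)
      show "inj_on (\<lambda>p. (b p, h (b p) p)) I"
        using h_eq by (auto simp: inj_on_def)
      show "(\<lambda>p. (b p, h (b p) p)) ` I = pverts (joined_union P F)"
      proof (intro equalityI subsetI)
        fix a assume "a \<in> pverts (joined_union P F)"
        then obtain u x where a: "a = (u, x)" "u \<in> pverts P" "x \<in> pverts (F u)"
          by (auto simp: joined_union_def)
        then obtain p where "p \<in> I" "b p = u" "x = h u p"
          using hF[of u] by (auto simp: bij_betw_def)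
        with a show "a \<in> (\<lambda>p. (b p, h (b p) p)) ` I" by auto
      qed (use b h_in in \<open>auto simp: joined_union_def\<close>)
    qed
    show "parcs (joined_union P F) \<subseteq> pverts (joined_union P F) \<times> pverts (joined_union P F)"
      using P FF by (auto simp: joined_union_def)
    fix p q assume pq: "p \<in> I" "q \<in> I"
    then have bpq: "b p \<in> pverts P" "b q \<in> pverts P" using b by auto
    show "(g p, g q) \<in> parcs G \<longleftrightarrow>
        ((b p, h (b p) p), (b q, h (b q) q)) \<in> parcs (joined_union P F)"
    proof (cases "b p = b q")
      case True
      \<comment> \<open>Within one block adjacency means having different numbers; irreflexivity of
        the parent excludes a join of the block with itself.\<close>
      then have "h (b p) p = h (b q) q \<longleftrightarrow> p = q" using h_eq[OF pq] by simp
      with True show ?thesis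
        using bpq h_in[OF pq(1)] h_in[OF pq(2)] irrefl
        by (simp add: arcs[OF pq] in_parcs_joined_union FF)
    next
      case False
      then show ?thesis
        using h_in[OF pq(1)] h_in[OF pq(2)] by (auto simp: arcs[OF pq] in_parcs_joined_union)
    qed
  qed
qed

section \<open>Words acting on normal forms\<close>

text \<open>
  The pair \<open>(i, b)\<close> stands for the normal form \<open>r\<^sup>i\<close> (\<open>b = False\<close>) or \<open>r\<^sup>i s\<close>
  (\<open>b = True\<close>), on which a letter acts by left multiplication. That the relations act
  trivially is what keeps the \<open>4n\<close> normal forms distinct in the presented group.
\<close>
fun quat_act :: "nat \<Rightarrow> quat_gen \<times> bool \<Rightarrow> int \<times> bool \<Rightarrow> int \<times> bool" where
  "quat_act n (gen_r, e) (i, b) = ((if e then i + 1 else i - 1) mod (2 * int n), b)"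
| "quat_act n (gen_s, e) (i, b) = ((if b = e then int n - i else - i) mod (2 * int n), \<not> b)"

text \<open>Every letter reduces its result modulo \<open>2 * n\<close>, so the assumption matters
  only for the empty word.\<close>

lemma quat_act_mod:
  assumes "i mod (2 * int n) = i"
  shows "fst (foldr (quat_act n) w (i, b)) mod (2 * int n) = fst (foldr (quat_act n) w (i, b))"
proof (induction w)
  case Nil
  show ?case by (simp add: assms)
next
  case (Cons x w)
  obtain g e where x: "x = (g, e)" by (cases x)
  obtain j c where j: "foldr (quat_act n) w (i, b) = (j, c)" by (cases "foldr (quat_act n) w (i, b)")
  show ?case by (cases g) (simp_all add: x j)
qed

lemma foldr_quat_act_replicate:
  assumes "i mod (2 * int n) = i"
  shows "foldr (quat_act n) (replicate k (gen_r, True)) (i, b) = ((i + int k) mod (2 * int n), b)"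
  by (induction k) (use assms in \<open>simp_all add: mod_simps ac_simps\<close>)

text \<open>Makes the action an invariant of group elements. Exponents have to be reduced because a
  cancelling pair of letters returns \<open>i mod (2 * int n)\<close>; in the \<open>append\<close>
  case \<open>quat_act_mod\<close> supplies this for the intermediate result.\<close>

lemma quat_act_pres_eq:
  assumes "pres_eq (quat_rels n) u v" "i mod (2 * int n) = i"
  shows "foldr (quat_act n) u (i, b) = foldr (quat_act n) v (i, b)"
  using assms
proof (induction arbitrary: i b)
  case (relation u v)
  then consider "u = replicate (2 * n) (gen_r, True)" "v = []"
    | "u = [(gen_s, True), (gen_s, True)]" "v = replicate n (gen_r, True)"
    | "u = [(gen_s, False), (gen_r, True), (gen_s, True)]" "v = [(gen_r, False)]"
    by (auto simp: quat_rels_def)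
  then show ?case
  proof cases
    case 1
    with relation.prems show ?thesis
      by (simp add: foldr_quat_act_replicate del: foldr_replicate)
  next
    case 2
    have "foldr (quat_act n) u (i, b) = ((i + int n) mod (2 * int n), b)"
    proof (cases b)
      case True
      \<comment> \<open>The two sides differ by exactly \<open>2 * int n\<close> before
        reduction.\<close>
      have "- (int n - i) mod (2 * int n) = (i + int n) mod (2 * int n)"
        by (simp add: mod_eq_dvd_iff)
      with True 2 show ?thesis by (simp add: mod_minus_eq)
    next
      case False
      with 2 show ?thesis by (simp add: mod_diff_right_eq add.commute)
    qed
    with 2 relation.prems show ?thesis
      by (simp only: foldr_quat_act_replicate)
  next
    case 3
    then show ?thesis by (simp add: mod_simps ac_simps)
  qed
next
  case (cancel x e)
  then show ?case by (cases x; cases e; cases b) (simp_all add: mod_simps)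
next
  case refl
  show ?case by (rule HOL.refl)
next
  case sym
  then show ?case by simp
next
  case trans
  then show ?case by simp
next
  case (append u u' v v')
  obtain j c where j: "foldr (quat_act n) v (i, b) = (j, c)" by (cases "foldr (quat_act n) v (i, b)")
  moreover have "j mod (2 * int n) = j"
    using quat_act_mod[OF append.prems, of v b] j by simp
  ultimately show ?case
    using append.IH(1)[of j c] append.IH(2)[OF append.prems, of b] by simp
qed

section \<open>Powers in the generalized quaternion group\<close>

text \<open>Only the relations are assumed, so normal forms may still coincide. \<open>r_s_r\<close>
  is the conjugation relation rewritten without inverses.\<close>

locale quaternion_relations = group G for G (structure) +
  fixes r s :: 'a and n :: nat
  assumes n_pos: "n > 0"
    and r_closed [simp]: "r \<in> carrier G" and s_closed [simp]: "s \<in> carrier G"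
    and r_pow_2n: "r [^] (2 * n) = \<one>"
    and s_square: "s \<otimes> s = r [^] n"
    and r_s_r: "r \<otimes> s \<otimes> r = s"
begin

definition coord :: "nat \<times> bool \<Rightarrow> 'a" where
  "coord = (\<lambda>(i, e). r [^] i \<otimes> (if e then s else \<one>))"

lemma coord_simps [simp]: "coord (i, False) = r [^] i" "coord (i, True) = r [^] i \<otimes> s"
  by (simp_all add: coord_def)

lemma coord_closed [simp]: "coord p \<in> carrier G"
  by (cases p) (simp add: coord_def)

lemma r_pow_mult_2n: "r [^] (2 * n * k) = \<one>"
  using nat_pow_pow[OF r_closed, of "2 * n" k] by (simp add: r_pow_2n)

lemma r_pow_cong:
  assumes "[i = j] (mod 2 * n)"
  shows "r [^] i = r [^] j"
proof -
  have *: "r [^] k = r [^] (k mod (2 * n))" for k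
  proof -
    have "r [^] k = r [^] (2 * n * (k div (2 * n)) + k mod (2 * n))" by simp
    also have "\<dots> = r [^] (k mod (2 * n))"
      by (simp only: nat_pow_mult[OF r_closed, symmetric] r_pow_mult_2n) simp
    finally show ?thesis .
  qed
  show ?thesis
    using *[of i] *[of j] assms by (simp add: cong_def)
qed

lemma r_pow_s_r_pow: "r [^] (i::nat) \<otimes> s \<otimes> r [^] i = s"
proof (induction i)
  case 0
  show ?case by simp
next
  case (Suc i)
  have "r [^] Suc i \<otimes> s \<otimes> r [^] Suc i = (r [^] i \<otimes> r) \<otimes> s \<otimes> (r \<otimes> r [^] i)"
    by (simp only: nat_pow_Suc nat_pow_Suc2[OF r_closed, symmetric])
  also have "\<dots> = r [^] i \<otimes> (r \<otimes> s \<otimes> r) \<otimes> r [^] i"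
    by (simp add: m_assoc)
  finally show ?case by (simp only: r_s_r Suc.IH)
qed

text \<open>Provides the inverse of \<open>r [^] i\<close> as a power with natural exponent. The
  multiple \<open>2 * n * i\<close> is at least \<open>i\<close>, so the subtraction never
  truncates.\<close>

lemma r_pow_complement: "r [^] (2 * n * i - i) \<otimes> r [^] i = \<one>"
proof -
  have "2 * n * i - i + i = 2 * n * i" using n_pos by simp
  then show ?thesis by (simp add: nat_pow_mult r_pow_mult_2n)
qed

lemma coord_reflection_square: "coord (j, True) \<otimes> coord (j, True) = r [^] n"
proof -
  have "coord (j, True) \<otimes> coord (j, True) = r [^] j \<otimes> s \<otimes> r [^] j \<otimes> s"
    by (simp add: m_assoc)
  then show ?thesis by (simp only: r_pow_s_r_pow s_square)
qed

text \<open>Every element \<open>coord (j, True)\<close> has square \<open>r [^] n\<close>, so its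
  even powers are powers of \<open>r [^] n\<close> and its odd powers lie outside the even ones'
  form, as \<open>coord (n * k + j, True)\<close>.\<close>

lemma coord_reflection_pow_even: "coord (j, True) [^] (2 * k) = r [^] (n * k)"
proof -
  have "coord (j, True) [^] (2 * k) = (coord (j, True) [^] (2::nat)) [^] k"
    by (simp only: nat_pow_pow coord_closed)
  also have "coord (j, True) [^] (2::nat) = r [^] n"
    using coord_reflection_square by (simp add: numeral_2_eq_2 del: coord_simps)
  finally show ?thesis by (simp add: nat_pow_pow)
qed

lemma coord_reflection_pow_odd: "coord (j, True) [^] (2 * k + 1) = coord (n * k + j, True)"
  using coord_reflection_pow_even[of j k]
  by (simp add: m_assoc[symmetric] nat_pow_mult)

lemma s_r_pow: "s \<otimes> r [^] (i::nat) = r [^] (2 * n * i - i) \<otimes> s"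
proof -
  have "s \<otimes> r [^] i = (r [^] (2 * n * i - i) \<otimes> r [^] i) \<otimes> (s \<otimes> r [^] i)"
    by (simp add: r_pow_complement)
  also have "\<dots> = r [^] (2 * n * i - i) \<otimes> (r [^] i \<otimes> s \<otimes> r [^] i)"
    by (simp add: m_assoc)
  finally show ?thesis by (simp add: r_pow_s_r_pow)
qed

text \<open>First of the closure facts: left multiplication by a generator or its inverse preserves
  \<open>range coord\<close>. Induction on words then brings every element of the presented group
  into normal form.\<close>

lemma r_mult_coord: "r \<otimes> coord p \<in> range coord"
proof (cases p)
  case (Pair i e)
  have "r \<otimes> coord p = coord (Suc i, e)"
    unfolding Pair coord_def
    by (simp only: prod.case nat_pow_Suc2[OF r_closed]) (simp add: m_assoc)
  then show ?thesis by simp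
qed

lemma s_mult_coord: "s \<otimes> coord p \<in> range coord"
proof (cases p)
  case (Pair i e)
  let ?j = "2 * n * i - i"
  have "s \<otimes> coord p = coord (if e then ?j + n else ?j, \<not> e)"
  proof (cases e)
    case True
    have "s \<otimes> (r [^] i \<otimes> s) = r [^] ?j \<otimes> (s \<otimes> s)"
      by (simp add: m_assoc[symmetric] s_r_pow)
    then show ?thesis using Pair True by (simp add: s_square nat_pow_mult)
  next
    case False
    then show ?thesis using Pair by (simp add: s_r_pow)
  qed
  then show ?thesis by simp
qed

lemma r_pow_mult_coord: "r [^] (k::nat) \<otimes> coord p \<in> range coord"
proof (induction k)
  case 0
  show ?case by simp
next
  case (Suc k)
  have "r [^] Suc k \<otimes> coord p = r \<otimes> (r [^] k \<otimes> coord p)"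
    by (simp only: nat_pow_Suc2[OF r_closed]) (simp add: m_assoc)
  then show ?case using Suc r_mult_coord by auto
qed

lemma inv_r: "inv r = r [^] (2 * n - 1)"
proof (rule inv_equality)
  have "r [^] (2 * n - 1) \<otimes> r = r [^] Suc (2 * n - 1)" by simp
  also have "Suc (2 * n - 1) = 2 * n" using n_pos by simp
  finally show "r [^] (2 * n - 1) \<otimes> r = \<one>" by (simp add: r_pow_2n)
qed simp_all

lemma inv_s: "inv s = r [^] n \<otimes> s"
proof (rule inv_equality)
  have "r [^] n \<otimes> s \<otimes> s = r [^] n \<otimes> r [^] n" by (simp add: m_assoc s_square)
  then show "r [^] n \<otimes> s \<otimes> s = \<one>" by (simp add: nat_pow_mult r_pow_2n flip: mult_2)
qed simp_all

lemma inv_r_mult_coord: "inv r \<otimes> coord p \<in> range coord"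
  by (simp add: inv_r r_pow_mult_coord)

lemma inv_s_mult_coord: "inv s \<otimes> coord p \<in> range coord"
proof -
  obtain q where "s \<otimes> coord p = coord q" using s_mult_coord[of p] by auto
  then have "inv s \<otimes> coord p = r [^] n \<otimes> coord q" by (simp add: inv_s m_assoc)
  then show ?thesis by (simp add: r_pow_mult_coord)
qed

end

text \<open>These assumptions already separate all normal forms: if \<open>r [^] i\<close> equalled
  \<open>r [^] j \<otimes> s\<close>, cancelling \<open>r [^] j\<close> would make \<open>s\<close>
  a power of \<open>r\<close>.\<close>

locale quaternion_coordinates = quaternion_relations +
  assumes carrier_subset: "carrier G \<subseteq> range coord"
    and r_pow_eqD: "r [^] (i::nat) = r [^] (j::nat) \<Longrightarrow> [i = j] (mod 2 * n)"
    and r_pow_neq_s: "r [^] (i::nat) \<noteq> s"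
begin

lemma r_pow_eq_iff: "r [^] (i::nat) = r [^] (j::nat) \<longleftrightarrow> [i = j] (mod 2 * n)"
  using r_pow_eqD r_pow_cong by blast

lemma rotation_neq_reflection: "r [^] (i::nat) \<noteq> r [^] (j::nat) \<otimes> s"
proof
  assume eq: "r [^] i = r [^] j \<otimes> s"
  have "r [^] (2 * n * j - j + i) = r [^] (2 * n * j - j) \<otimes> r [^] i"
    by (simp add: nat_pow_mult)
  also have "\<dots> = r [^] (2 * n * j - j) \<otimes> r [^] j \<otimes> s"
    unfolding eq by (simp add: m_assoc)
  also have "\<dots> = s" by (simp add: r_pow_complement)
  finally show False using r_pow_neq_s by blast
qed

lemma coord_eq_iff: "coord (i, e) = coord (j, f) \<longleftrightarrow> [i = j] (mod 2 * n) \<and> e = f"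
  using rotation_neq_reflection[of i j] rotation_neq_reflection[of j i]
  by (cases e; cases f) (auto simp: r_pow_eq_iff)

text \<open>The exponents run from 1 to \<open>2 * n\<close>, rather than from 0, to match the index
  set of \<open>card_gcd_eq_totient\<close>.\<close>

lemma bij_betw_coord: "bij_betw coord ({0<..2 * n} \<times> UNIV) (carrier G)"
proof (intro bij_betw_imageI)
  show "inj_on coord ({0<..2 * n} \<times> UNIV)"
  proof (rule inj_onI, clarify)
    fix i e j f
    assume ij: "i \<in> {0<..2 * n}" "j \<in> {0<..2 * n}" and eq: "coord (i, e) = coord (j, f)"
    from eq have "i mod (2 * n) = j mod (2 * n)" "e = f"
      by (simp_all only: coord_eq_iff cong_def)
    with ij show "i = j \<and> e = f"
      by (cases "i = 2 * n"; cases "j = 2 * n") auto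
  qed
  show "coord ` ({0<..2 * n} \<times> UNIV) = carrier G"
  proof (intro equalityI subsetI)
    fix x assume "x \<in> carrier G"
    then obtain i e where x: "x = coord (i, e)" using carrier_subset by auto
    \<comment> \<open>Residue 0 is represented by \<open>2 * n\<close>, as 0 is outside the index
      set.\<close>
    define j where "j = (if i mod (2 * n) = 0 then 2 * n else i mod (2 * n))"
    have "j \<in> {0<..2 * n}" using n_pos by (auto simp: j_def less_imp_le)
    moreover have "x = coord (j, e)"
      unfolding x coord_eq_iff by (simp add: j_def cong_def)
    ultimately show "x \<in> coord ` ({0<..2 * n} \<times> UNIV)" by auto
  qed auto
qed

section \<open>The power relation in coordinates\<close>

lemma rotation_power_of_rotation_iff:
  "(\<exists>k::nat. k > 0 \<and> coord (j, False) = coord (i, False) [^] k) \<longleftrightarrow> gcd i (2 * n) dvd j"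
proof
  assume "\<exists>k::nat. k > 0 \<and> coord (j, False) = coord (i, False) [^] k"
  then obtain k :: nat where "[j = i * k] (mod 2 * n)"
    by (auto simp: nat_pow_pow r_pow_eq_iff)
  then have "[j = i * k] (mod gcd i (2 * n))" by (rule cong_dvd_modulus_nat) simp
  then show "gcd i (2 * n) dvd j" by (simp add: cong_dvd_iff)
next
  assume "gcd i (2 * n) dvd j"
  then obtain q where q: "j = gcd i (2 * n) * q" ..
  \<comment> \<open>Bezout: the gcd is a multiple of \<open>i\<close> modulo \<open>2 * n\<close>,
    hence so is \<open>j\<close>.\<close>
  obtain x where "[i * x = gcd i (2 * n)] (mod 2 * n)"
    using cong_solve_nat by blast
  then have "[i * x * q = j] (mod 2 * n)" unfolding q by (rule cong_scalar_right)
  \<comment> \<open>Adding \<open>2 * n\<close> does not change the power and makes the exponent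
    positive even if \<open>x * q\<close> is 0.\<close>
  then have "[j = i * (x * q + 2 * n)] (mod 2 * n)"
    by (simp add: cong_def algebra_simps)
  then have "coord (j, False) = coord (i, False) [^] (x * q + 2 * n)"
    by (simp add: nat_pow_pow r_pow_eq_iff)
  then show "\<exists>k::nat. k > 0 \<and> coord (j, False) = coord (i, False) [^] k"
    using n_pos by (intro exI[of _ "x * q + 2 * n"]) simp
qed

lemma reflection_not_power_of_rotation: "coord (j, True) \<noteq> coord (i, False) [^] (k::nat)"
  using rotation_neq_reflection[of "i * k" j] by (simp add: nat_pow_pow)

lemma power_of_reflection_iff:
  "(\<exists>k::nat. k > 0 \<and> coord (i, e) = coord (j, True) [^] k) \<longleftrightarrow>
    (if e then [i = j] (mod n) else n dvd i)"
proof
  assume "\<exists>k::nat. k > 0 \<and> coord (i, e) = coord (j, True) [^] k"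
  then obtain k :: nat where k: "coord (i, e) = coord (j, True) [^] k" by blast
  show "if e then [i = j] (mod n) else n dvd i"
  proof (cases "even k")
    case True
    then obtain m where "k = 2 * m" ..
    then have "coord (i, e) = coord (n * m, False)"
      using k by (simp only: coord_reflection_pow_even coord_simps(1))
    then have "e = False" "[i = n * m] (mod 2 * n)" by (simp_all only: coord_eq_iff)
    then show ?thesis
      using cong_dvd_modulus_nat[of i "n * m" "2 * n" n] by (simp add: cong_dvd_iff)
  next
    case False
    then obtain m where "k = 2 * m + 1" by (rule oddE)
    then have "coord (i, e) = coord (n * m + j, True)"
      using k by (simp only: coord_reflection_pow_odd)
    then have "e = True" "[i = n * m + j] (mod 2 * n)" by (simp_all only: coord_eq_iff)
    then show ?thesis
      using cong_dvd_modulus_nat[of i "n * m + j" "2 * n" n] by (simp add: cong_def)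
  qed
next
  assume *: "if e then [i = j] (mod n) else n dvd i"
  show "\<exists>k::nat. k > 0 \<and> coord (i, e) = coord (j, True) [^] k"
  proof (cases e)
    case True
    with * obtain k1 k2 where "j + k1 * n = i + k2 * n"
      by (auto simp: cong_iff_lin_nat)
    \<comment> \<open>Adding \<open>k2 * n\<close> to both sides turns a congruence modulo
      \<open>n\<close> into one modulo \<open>2 * n\<close>.\<close>
    then have "n * (k1 + k2) + j = i + k2 * (2 * n)" by (simp add: algebra_simps)
    then have "[i = n * (k1 + k2) + j] (mod 2 * n)" by (simp only: cong_def mod_mult_self1)
    then have "coord (i, e) = coord (n * (k1 + k2) + j, True)"
      using True by (simp only: coord_eq_iff)
    then have "coord (i, e) = coord (j, True) [^] (2 * (k1 + k2) + 1)"
      by (simp only: coord_reflection_pow_odd)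
    then show ?thesis by (intro exI[of _ "2 * (k1 + k2) + 1"]) simp
  next
    case False
    with * obtain m where "i = n * m" by (auto elim: dvdE)
    \<comment> \<open>The summand 2 contributes a full period \<open>2 * n\<close> and keeps the
      exponent positive for \<open>m = 0\<close>.\<close>
    then have "[i = n * (m + 2)] (mod 2 * n)"
      by (simp only: cong_def distrib_left mult.commute[of n 2] mod_add_self2)
    then have "coord (i, e) = r [^] (n * (m + 2))"
      using False by (simp only: coord_simps r_pow_eq_iff)
    then have "coord (i, e) = coord (j, True) [^] (2 * (m + 2))"
      by (simp only: coord_reflection_pow_even)
    then show ?thesis by (intro exI[of _ "2 * (m + 2)"]) simp
  qed
qed

text \<open>In the mixed cases only one direction survives, since powers of \<open>r [^] i\<close>
  never involve \<open>s\<close>.\<close>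

lemma power_graph_arc_iff:
  assumes p: "p \<in> {0<..2 * n} \<times> UNIV" and q: "q \<in> {0<..2 * n} \<times> UNIV"
  shows "(coord p, coord q) \<in> parcs (power_graph G) \<longleftrightarrow> p \<noteq> q \<and>
    (case (p, q) of
      ((i, False), (j, False)) \<Rightarrow> gcd i (2 * n) dvd j \<or> gcd j (2 * n) dvd i
    | ((i, False), (j, True)) \<Rightarrow> n dvd i
    | ((i, True), (j, False)) \<Rightarrow> n dvd j
    | ((i, True), (j, True)) \<Rightarrow> [i = j] (mod n))"
proof -
  have "coord p = coord q \<longleftrightarrow> p = q"
    using bij_betw_coord p q by (auto simp: bij_betw_def dest: inj_onD)
  then have *: "(coord p, coord q) \<in> parcs (power_graph G) \<longleftrightarrow> p \<noteq> q \<and>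
      ((\<exists>k::nat. k > 0 \<and> coord q = coord p [^] k) \<or> (\<exists>k::nat. k > 0 \<and> coord p = coord q [^] k))"
    by (auto simp: power_graph_def)
  obtain i e j f where "p = (i, e)" "q = (j, f)" by (cases p, cases q)
  then show ?thesis
    unfolding *
    by (cases e; cases f)
      (simp_all only: rotation_power_of_rotation_iff power_of_reflection_iff
        reflection_not_power_of_rotation cong_sym_eq simp_thms prod.case bool.case if_True if_False
        disj_commute)
qed

end

text \<open>Closure under letters shows that the normal forms exhaust the group; the action of words
  shows that they do not collapse.\<close>

lemma quaternion_coordinates_quaternion_group:
  assumes "n > 0"
  shows "quaternion_coordinates (quaternion_group n)
    (pres_class (quat_rels n) [(gen_r, True)]) (pres_class (quat_rels n) [(gen_s, True)]) n"
proof -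
  define G where "G = quaternion_group n"
  define cls where "cls = pres_class (quat_rels n)"
  define r where "r = cls [(gen_r, True)]"
  define s where "s = cls [(gen_s, True)]"
  interpret group G
    unfolding G_def quaternion_group_def by (rule group_presented_group)
  have mult: "cls u \<otimes>\<^bsub>G\<^esub> cls v = cls (u @ v)" for u v
    by (simp add: G_def quaternion_group_def cls_def mult_presented_group)
  have one: "\<one>\<^bsub>G\<^esub> = cls []" and carrier: "carrier G = range cls"
    by (simp_all add: G_def quaternion_group_def cls_def presented_group_def)
  have eqI: "cls u = cls v" if "(u, v) \<in> quat_rels n" for u v
    using that by (simp add: cls_def pres_class_eq_iff pres_eq.relation)
  have r_pow: "r [^]\<^bsub>G\<^esub> k = cls (replicate k (gen_r, True))" for k :: nat
    by (induction k) (simp_all add: one r_def mult replicate_append_same)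
  have cancel: "cls [(x, False)] = inv\<^bsub>G\<^esub> (cls [(x, True)])" for x
  proof (rule inv_equality[symmetric])
    show "cls [(x, False)] \<otimes>\<^bsub>G\<^esub> cls [(x, True)] = \<one>\<^bsub>G\<^esub>"
      using pres_eq.cancel[of "quat_rels n" x False]
      by (simp add: mult one) (simp add: cls_def pres_class_eq_iff)
  qed (simp_all add: carrier)
  have r: "r \<in> carrier G" and s: "s \<in> carrier G"
    by (simp_all add: r_def s_def carrier)
  interpret quaternion_relations G r s n
  proof
    show "r [^]\<^bsub>G\<^esub> (2 * n) = \<one>\<^bsub>G\<^esub>"
      unfolding r_pow one by (rule eqI) (simp add: quat_rels_def)
    show "s \<otimes>\<^bsub>G\<^esub> s = r [^]\<^bsub>G\<^esub> n"
      unfolding r_pow by (simp only: s_def mult append.simps) (rule eqI, simp add: quat_rels_def)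
    have "cls [(gen_s, False)] \<otimes>\<^bsub>G\<^esub> r \<otimes>\<^bsub>G\<^esub> s = cls [(gen_r, False)]"
      by (simp only: r_def s_def mult append.simps) (rule eqI, simp add: quat_rels_def)
    then have "inv\<^bsub>G\<^esub> s \<otimes>\<^bsub>G\<^esub> r \<otimes>\<^bsub>G\<^esub> s = inv\<^bsub>G\<^esub> r"
      by (simp only: cancel r_def s_def)
    \<comment> \<open>Multiplying by \<open>s\<close> on the left and \<open>r\<close> on the right
      removes both inverses.\<close>
    then have "s \<otimes>\<^bsub>G\<^esub> (inv\<^bsub>G\<^esub> s \<otimes>\<^bsub>G\<^esub> r \<otimes>\<^bsub>G\<^esub> s) \<otimes>\<^bsub>G\<^esub> r = s \<otimes>\<^bsub>G\<^esub> inv\<^bsub>G\<^esub> r \<otimes>\<^bsub>G\<^esub> r"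
      by simp
    then show "r \<otimes>\<^bsub>G\<^esub> s \<otimes>\<^bsub>G\<^esub> r = s"
      using r s by (simp add: m_assoc flip: m_assoc[of s "inv\<^bsub>G\<^esub> s"])
  qed (use assms r s in simp_all)
  have letter_mult_coord: "cls [a] \<otimes>\<^bsub>G\<^esub> coord p \<in> range coord" for a p
  proof -
    obtain x e where a: "a = (x, e)" by (cases a)
    show ?thesis
      using r_mult_coord[of p] s_mult_coord[of p] inv_r_mult_coord[of p] inv_s_mult_coord[of p]
      unfolding a by (cases x; cases e) (simp_all add: cancel flip: r_def s_def)
  qed
  have cls_coord: "cls w \<in> range coord" for w
  proof (induction w)
    case Nil
    have "cls [] = coord (0, False)" by (simp flip: one)
    then show ?case by (rule range_eqI)
  next
    case (Cons a w)
    then obtain p where "cls w = coord p" by auto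
    then have "cls (a # w) = cls [a] \<otimes>\<^bsub>G\<^esub> coord p" using mult[of "[a]" w] by simp
    then show ?case by (simp add: letter_mult_coord)
  qed
  \<comment> \<open>\<open>(0, False)\<close> stands for the identity, so the action on it evaluates
    a word to its normal form. Equal classes have equal values.\<close>
  have act_eq: "foldr (quat_act n) u (0, False) = foldr (quat_act n) v (0, False)"
    if "cls u = cls v" for u v
    using that by (intro quat_act_pres_eq) (simp_all add: cls_def pres_class_eq_iff)
  have "quaternion_coordinates G r s n"
  proof
    show "carrier G \<subseteq> range coord" using cls_coord by (auto simp: carrier)
  next
    fix i j :: nat
    assume "r [^]\<^bsub>G\<^esub> i = r [^]\<^bsub>G\<^esub> j"
    then have "int i mod (2 * int n) = int j mod (2 * int n)"
      using act_eq[of "replicate i (gen_r, True)" "replicate j (gen_r, True)"]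
      by (simp add: r_pow foldr_quat_act_replicate del: foldr_replicate)
    then have "int (i mod (2 * n)) = int (j mod (2 * n))"
      by (simp add: of_nat_mod)
    then show "[i = j] (mod 2 * n)"
      by (simp only: cong_def of_nat_eq_iff)
  next
    fix i :: nat
    \<comment> \<open>The second components differ: \<open>False\<close> for a power of
      \<open>r\<close>, \<open>True\<close> for \<open>s\<close>.\<close>
    show "r [^]\<^bsub>G\<^esub> i \<noteq> s"
      using act_eq[of "replicate i (gen_r, True)" "[(gen_s, True)]"]
      by (auto simp: r_pow s_def foldr_quat_act_replicate simp del: foldr_replicate)
  qed
  then show ?thesis by (simp add: G_def r_def s_def cls_def)
qed

section \<open>The parent graph as a divisibility graph\<close>

text \<open>The order of the group elements that form the block of a parent vertex.\<close>
fun vertex_order :: "nat \<Rightarrow> (nat \<Rightarrow> nat) \<Rightarrow> parent_vertex \<Rightarrow> nat" where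
  "vertex_order n d V1 = 1"
| "vertex_order n d V2 = 2"
| "vertex_order n d V3 = 2 * n"
| "vertex_order n d (W i) = d i"
| "vertex_order n d (Y k) = 4"

text \<open>The \<open>Y\<close> vertices are left out because they all have order 4, so
  \<open>vertex_order\<close> could not tell them apart.\<close>

definition rotation_vertices :: "nat \<Rightarrow> parent_vertex set" where
  "rotation_vertices t = {V1, V2, V3} \<union> W ` {1..t}"

lemma pverts_parent_graph: "pverts (parent_graph n t d) = rotation_vertices t \<union> Y ` {1..n}"
  by (auto simp: parent_graph_def parent_verts_def rotation_vertices_def)

lemma parent_adj_simps [simp]:
  "(V1, v) \<in> parent_adj n t d \<longleftrightarrow> v \<in> parent_verts n t \<and> v \<noteq> V1"
  "(V2, v) \<in> parent_adj n t d \<longleftrightarrow>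
    v = V3 \<or> (\<exists>k\<in>{1..n}. v = Y k) \<or> (\<exists>i\<in>{1..t}. v = W i \<and> 2 dvd d i)"
  "(V3, v) \<in> parent_adj n t d \<longleftrightarrow> (\<exists>i\<in>{1..t}. v = W i)"
  "(W i, v) \<in> parent_adj n t d \<longleftrightarrow>
    i \<in> {1..t} \<and> (\<exists>j\<in>{1..t}. v = W j \<and> i \<noteq> j \<and> (d i dvd d j \<or> d j dvd d i))"
  "(Y k, v) \<notin> parent_adj n t d"
  unfolding parent_adj_def by blast+

lemma parent_verts_simps [simp]:
  "V1 \<in> parent_verts n t" "V2 \<in> parent_verts n t" "V3 \<in> parent_verts n t"
  "W i \<in> parent_verts n t \<longleftrightarrow> i \<in> {1..t}" "Y k \<in> parent_verts n t \<longleftrightarrow> k \<in> {1..n}"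
  unfolding parent_verts_def by blast+

lemma parcs_parent_graph_iff:
  "(u, v) \<in> parcs (parent_graph n t d) \<longleftrightarrow> (u, v) \<in> parent_adj n t d \<or> (v, u) \<in> parent_adj n t d"
  by (simp add: parent_graph_def)

lemma parent_adj_subset: "parent_adj n t d \<subseteq> parent_verts n t \<times> parent_verts n t"
proof (rule subrelI)
  fix u v assume "(u, v) \<in> parent_adj n t d"
  then show "(u, v) \<in> parent_verts n t \<times> parent_verts n t"
    by (cases u) (auto simp del: atLeastAtMost_iff)
qed

lemma parcs_parent_graph_subset:
  "parcs (parent_graph n t d) \<subseteq> pverts (parent_graph n t d) \<times> pverts (parent_graph n t d)"
  using parent_adj_subset[of n t d] by (auto simp: parent_graph_def)

lemma parent_graph_irrefl: "(u, u) \<notin> parcs (parent_graph n t d)"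
  by (cases u) (simp_all add: parcs_parent_graph_iff)

lemma Y_Y_notin_parcs: "(Y k, Y l) \<notin> parcs (parent_graph n t d)"
  by (simp add: parcs_parent_graph_iff)

lemma rotation_vertices_simps [simp]:
  "V1 \<in> rotation_vertices t" "V2 \<in> rotation_vertices t" "V3 \<in> rotation_vertices t"
  "W i \<in> rotation_vertices t \<longleftrightarrow> i \<in> {1..t}" "Y k \<notin> rotation_vertices t"
  unfolding rotation_vertices_def by blast+

context
  fixes n t :: nat and d :: "nat \<Rightarrow> nat"
  assumes n: "n \<ge> 2"
    and d: "bij_betw d {1..t} {k. k dvd 2 * n \<and> 1 < k \<and> k < 2 * n \<and> k \<noteq> 2}"
begin

lemma d_in: "d i dvd 2 * n" "1 < d i" "d i < 2 * n" "d i \<noteq> 2" if "i \<in> {1..t}"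
  using bij_betw_apply[OF d that] by auto

lemma d_not_dvd_2: "\<not> d i dvd 2" and not_dvd_d: "\<not> 2 * n dvd d i" if "i \<in> {1..t}"
  using d_in[OF that] by (auto dest: dvd_imp_le)

text \<open>The divisors of \<open>2 * n\<close> are 1, 2, \<open>2 * n\<close> and the values of
  \<open>d\<close>; \<open>n \<ge> 2\<close> keeps 2 and \<open>2 * n\<close> distinct.\<close>

lemma bij_betw_vertex_order:
  "bij_betw (vertex_order n d) (rotation_vertices t) {k. k dvd 2 * n}"
proof (rule bij_betw_byWitness)
  let ?i = "the_inv_into {1..t} d"
  let ?v = "\<lambda>k. if k = 1 then V1 else if k = 2 then V2 else if k = 2 * n then V3 else W (?i k)"
  have inj: "inj_on d {1..t}" using d by (simp add: bij_betw_def)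
  have i: "?i k \<in> {1..t}" "d (?i k) = k" if "k dvd 2 * n" "k \<noteq> 1" "k \<noteq> 2" "k \<noteq> 2 * n" for k
  proof -
    have "0 < k" "k \<le> 2 * n" using that n by (auto simp: dvd_imp_le intro: Nat.gr0I)
    with that have "k \<in> {k. k dvd 2 * n \<and> 1 < k \<and> k < 2 * n \<and> k \<noteq> 2}" by auto
    then show "?i k \<in> {1..t}" "d (?i k) = k"
      using f_the_inv_into_f_bij_betw[OF d] bij_betw_apply[OF bij_betw_the_inv_into[OF d]]
      by simp_all
  qed
  show "\<forall>u\<in>rotation_vertices t. ?v (vertex_order n d u) = u"
  proof
    fix u assume "u \<in> rotation_vertices t"
    then consider "u = V1" | "u = V2" | "u = V3" | j where "u = W j" "j \<in> {1..t}"
      by (auto simp: rotation_vertices_def)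
    then show "?v (vertex_order n d u) = u"
    proof cases
      case 4
      then show ?thesis using d_in[of j] the_inv_into_f_f[OF inj] by simp
    qed (use n in simp_all)
  qed
  show "\<forall>k\<in>{k. k dvd 2 * n}. vertex_order n d (?v k) = k"
    using i by simp
  show "vertex_order n d ` rotation_vertices t \<subseteq> {k. k dvd 2 * n}"
    using d_in by (auto simp: rotation_vertices_def)
  show "?v ` {k. k dvd 2 * n} \<subseteq> rotation_vertices t"
    using i(1) by (auto simp: rotation_vertices_def simp del: atLeastAtMost_iff)
qed

text \<open>Order 1 divides every order and every order divides \<open>2 * n\<close>. Between
  \<open>V2\<close> and \<open>W i\<close> the list names only \<open>2 dvd d i\<close>, which
  suffices because \<open>d i\<close> never divides 2.\<close>

lemma rotation_parcs_iff:
  assumes "u \<in> rotation_vertices t" "v \<in> rotation_vertices t"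
  shows "(u, v) \<in> parcs (parent_graph n t d) \<longleftrightarrow> u \<noteq> v \<and>
    (vertex_order n d u dvd vertex_order n d v \<or> vertex_order n d v dvd vertex_order n d u)"
  using assms d_in(1) d_not_dvd_2 not_dvd_d
  by (cases u; cases v) (auto simp: parcs_parent_graph_iff simp del: atLeastAtMost_iff)

text \<open>Only \<open>V1\<close> and \<open>V2\<close> have order dividing 2: for
  \<open>V3\<close> this fails by \<open>n \<ge> 2\<close>, for \<open>W i\<close> by
  \<open>d_not_dvd_2\<close>.\<close>

lemma rotation_Y_parcs_iff:
  assumes "u \<in> rotation_vertices t" "k \<in> {1..n}"
  shows "(u, Y k) \<in> parcs (parent_graph n t d) \<longleftrightarrow> vertex_order n d u dvd 2"
    and "(Y k, u) \<in> parcs (parent_graph n t d) \<longleftrightarrow> vertex_order n d u dvd 2"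
  using assms n d_not_dvd_2
  by (cases u; simp add: parcs_parent_graph_iff nat_dvd_not_less del: atLeastAtMost_iff)+

end

section \<open>Block sizes and divisor arithmetic\<close>

lemma parent_block_rotation:
  "u \<in> rotation_vertices t \<Longrightarrow> parent_block n d u = complete_graph (totient (vertex_order n d u))"
  by (auto simp: rotation_vertices_def)

text \<open>Complementary divisors reverse divisibility; this translates conditions on
  \<open>gcd i (2 * n)\<close> into conditions on the order of \<open>r [^] i\<close>.\<close>

lemma div_dvd_div_iff:
  fixes a b m :: nat
  assumes "a dvd m" "b dvd m" "m > 0"
  shows "m div a dvd m div b \<longleftrightarrow> b dvd a"
proof -
  obtain a' where "m = a * a'" using assms(1) ..
  moreover obtain b' where "m = b * b'" using assms(2) ..
  ultimately have m: "m = a * a'" "m = b * b'" .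
  have pos: "a > 0" "a' > 0" using m(1) assms(3) by simp_all
  have pos': "b > 0" "b' > 0" using m(2) assms(3) by simp_all
  have "a' dvd b' \<longleftrightarrow> a' * b dvd b' * b" using pos' by simp
  also have "b' * b = a' * a" using m by (simp only: mult.commute)
  also have "a' * b dvd a' * a \<longleftrightarrow> b dvd a" using pos by simp
  also have "a' = m div a" using m(1) pos by simp
  also have "b' = m div b" using m(2) pos' by simp
  finally show ?thesis .
qed

lemma div_eq_iff_eq_div:
  fixes a b m :: nat
  assumes "a dvd m" "b dvd m" "m > 0"
  shows "m div a = b \<longleftrightarrow> a = m div b"
proof -
  have "a > 0" "b > 0" using assms by (auto intro: Nat.gr0I)
  then have "m div a = b \<longleftrightarrow> m = b * a" "m div b = a \<longleftrightarrow> m = a * b"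
    using assms by (simp_all add: dvd_div_eq_mult)
  then show ?thesis by (auto simp: mult.commute)
qed

lemma Collect_Times_UNIV:
  assumes "\<And>i e. P (i, e) \<longleftrightarrow> e = c \<and> Q i"
  shows "{p \<in> A \<times> UNIV. P p} = {i \<in> A. Q i} \<times> {c}"
  using assms by auto

text \<open>The interval covers two full periods of length \<open>n\<close>. Residue 0 is special,
  being attained at \<open>n\<close> and at the endpoint \<open>2 * n\<close>, whose quotient is
  2.\<close>

lemma card_mod_eq:
  assumes "c < (n::nat)"
  shows "card {i \<in> {0<..2 * n}. i mod n = c} = 2"
proof -
  have "{i \<in> {0<..2 * n}. i mod n = c} = (if c = 0 then {n, 2 * n} else {c, n + c})"
  proof (intro equalityI subsetI)
    fix i assume i: "i \<in> {i \<in> {0<..2 * n}. i mod n = c}"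
    define q where "q = i div n"
    have iq: "i = q * n + c" using i by (auto simp: q_def)
    have "q < 3"
    proof (rule ccontr)
      assume "\<not> q < 3"
      then have "3 * n \<le> q * n" by simp
      with iq i assms show False by auto
    qed
    then consider "q = 0" | "q = 1" | "q = 2" by linarith
    then show "i \<in> (if c = 0 then {n, 2 * n} else {c, n + c})"
      using i iq by cases auto
  qed (use assms in \<open>auto split: if_splits\<close>)
  then show ?thesis using assms by (auto simp: card_insert_if)
qed

theorem theorem3p3:
  fixes n t :: nat and d :: "nat \<Rightarrow> nat"
  assumes "n \<ge> 2"
    and "bij_betw d {1..t} {k. k dvd 2 * n \<and> 1 < k \<and> k < 2 * n \<and> k \<noteq> 2}"
  shows "digraph_iso (with_proj (power_graph (quaternion_group n)))
           (with_proj (joined_union (parent_graph n t d) (parent_block n d)))"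
proof -
  note n = assms(1) and d = assms(2)
  let ?G = "quaternion_group n" and ?P = "parent_graph n t d" and ?R = "rotation_vertices t"
  let ?I = "{0<..2 * n} \<times> (UNIV :: bool set)"
  interpret quaternion_coordinates ?G "pres_class (quat_rels n) [(gen_r, True)]"
    "pres_class (quat_rels n) [(gen_s, True)]" n
    using n by (intro quaternion_coordinates_quaternion_group) simp
  note order = bij_betw_vertex_order[OF n d]
  note R_arc = rotation_parcs_iff[OF n d] and Y_arc = rotation_Y_parcs_iff[OF n d]
  define vert where "vert k = the_inv_into ?R (vertex_order n d) k" for k
  \<comment> \<open>This is the order of \<open>r [^] i\<close>.\<close>
  define rot_order where "rot_order i = 2 * n div gcd i (2 * n)" for i
  \<comment> \<open>Exponents that agree modulo \<open>n\<close> share a \<open>Y\<close> block,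
    matching the pair \<open>r [^] i \<otimes> s\<close>, \<open>r [^] (i + n) \<otimes> s\<close>.
    The shift by 1 is there because \<open>Y\<close> indices start at 1.\<close>
  define b where "b = (\<lambda>(i, e). if e then Y (i mod n + 1) else vert (rot_order i))"
  have b_simps: "b (i, False) = vert (rot_order i)" "b (i, True) = Y (i mod n + 1)" for i
    by (simp_all add: b_def)
  have rot_order_dvd: "rot_order i dvd 2 * n" for i
    by (rule dvdI[of _ _ "gcd i (2 * n)"]) (simp add: rot_order_def)
  have vert: "vert k \<in> ?R" "vertex_order n d (vert k) = k" if "k dvd 2 * n" for k
    using that order f_the_inv_into_f_bij_betw[OF order]
      bij_betw_apply[OF bij_betw_the_inv_into[OF order]] by (simp_all add: vert_def)
  have vert_eq: "vert k = u \<longleftrightarrow> k = vertex_order n d u" if "k dvd 2 * n" "u \<in> ?R" for k u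
    using that vert order by (metis bij_betw_inv_into_left)
  have rot_order_dvd_iff: "rot_order i dvd rot_order j \<longleftrightarrow> gcd j (2 * n) dvd i" for i j
    using n by (simp add: rot_order_def div_dvd_div_iff)
  \<comment> \<open>Here 2 is read as the complementary divisor \<open>2 * n div n\<close>.\<close>
  have rot_order_dvd_2: "rot_order i dvd 2 \<longleftrightarrow> n dvd i" for i
    using div_dvd_div_iff[of "gcd i (2 * n)" "2 * n" n] n by (simp add: rot_order_def)
  have Y_in: "i mod n + 1 \<in> {1..n}" for i
    using n by (simp add: Suc_le_eq)
  have Y_notin: "Y k \<notin> ?R" for k
    by simp
  have vert_neq_Y: "vert (rot_order i) \<noteq> Y k" for i k
    using vert(1)[OF rot_order_dvd[of i]] Y_notin by metis
  have vert_vert: "vert (rot_order i) = vert (rot_order j) \<or>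
      (vert (rot_order i), vert (rot_order j)) \<in> parcs ?P \<longleftrightarrow>
      gcd i (2 * n) dvd j \<or> gcd j (2 * n) dvd i" for i j
  proof -
    have "vert (rot_order i) = vert (rot_order j) \<Longrightarrow> rot_order i = rot_order j"
      using vert(2)[OF rot_order_dvd] by metis
    then show ?thesis
      unfolding R_arc[OF vert(1)[OF rot_order_dvd] vert(1)[OF rot_order_dvd]]
        vert(2)[OF rot_order_dvd] rot_order_dvd_iff[symmetric]
      by auto
  qed
  have vert_Y: "(vert (rot_order i), Y (j mod n + 1)) \<in> parcs ?P \<longleftrightarrow> n dvd i"
    "(Y (j mod n + 1), vert (rot_order i)) \<in> parcs ?P \<longleftrightarrow> n dvd i" for i j
    by (simp_all only: Y_arc[OF vert(1)[OF rot_order_dvd] Y_in] vert(2)[OF rot_order_dvd] rot_order_dvd_2)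
  show ?thesis
  proof (rule digraph_iso_joined_union_complete[where g = coord and I = ?I and b = b])
    show "bij_betw coord ?I (pverts (power_graph ?G))"
      using bij_betw_coord by (simp add: power_graph_def)
    show "finite ?I" by simp
    show "parcs (power_graph ?G) \<subseteq> pverts (power_graph ?G) \<times> pverts (power_graph ?G)"
      by (auto simp: power_graph_def)
    show "b ` ?I \<subseteq> pverts ?P"
      using vert(1)[OF rot_order_dvd] Y_in by (auto simp: b_def pverts_parent_graph)
    show "parent_block n d u = complete_graph (card {p \<in> ?I. b p = u})" if u: "u \<in> pverts ?P" for u
    proof (cases "u \<in> ?R")
      case True
      then have k: "vertex_order n d u dvd 2 * n" using order by (auto simp: bij_betw_def)
      \<comment> \<open>Rewrites the order condition as a gcd condition, whose solutions
        \<open>card_gcd_eq_totient\<close> counts.\<close>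
      have order_iff: "rot_order i = vertex_order n d u \<longleftrightarrow> gcd i (2 * n) = 2 * n div vertex_order n d u" for i
        using div_eq_iff_eq_div[of "gcd i (2 * n)" "2 * n" "vertex_order n d u"] k n
        by (simp add: rot_order_def)
      have "b (i, e) = u \<longleftrightarrow> e = False \<and> gcd i (2 * n) = 2 * n div vertex_order n d u" for i e
      proof (cases e)
        case True
        have "Y (i mod n + 1) \<noteq> u" using Y_notin \<open>u \<in> ?R\<close> by metis
        with True show ?thesis by (simp only: b_simps simp_thms)
      next
        case False
        then show ?thesis
          by (simp only: b_simps vert_eq[OF rot_order_dvd \<open>u \<in> ?R\<close>] order_iff simp_thms)
      qed
      then have "{p \<in> ?I. b p = u} =
          {i \<in> {0<..2 * n}. gcd i (2 * n) = 2 * n div vertex_order n d u} \<times> {False}"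
        by (rule Collect_Times_UNIV)
      moreover have "card {i \<in> {0<..2 * n}. gcd i (2 * n) = 2 * n div vertex_order n d u} =
          totient (vertex_order n d u)"
      proof (subst card_gcd_eq_totient)
        show div: "2 * n div vertex_order n d u dvd 2 * n"
          using k by (intro dvdI[of _ _ "vertex_order n d u"]) simp
        then show "totient (2 * n div (2 * n div vertex_order n d u)) = totient (vertex_order n d u)"
          using div_eq_iff_eq_div[OF div k] n by simp
      qed (use n in simp)
      ultimately show ?thesis
        using True by (simp add: parent_block_rotation card_cartesian_product)
    next
      case False
      then obtain k where k: "u = Y k" "k \<in> {1..n}" using u by (auto simp: pverts_parent_graph)
      have "b (i, e) = u \<longleftrightarrow> e = True \<and> i mod n = k - 1" for i e
      proof (cases e)
        case True
        then show ?thesis using k by (auto simp: b_simps)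
      next
        case False
        then show ?thesis by (simp only: b_simps k vert_neq_Y simp_thms)
      qed
      then have "{p \<in> ?I. b p = u} = {i \<in> {0<..2 * n}. i mod n = k - 1} \<times> {True}"
        by (rule Collect_Times_UNIV)
      moreover have "k - 1 < n" using k by auto
      ultimately show ?thesis
        by (simp only: k parent_block.simps card_cartesian_product card_mod_eq) simp
    qed
    fix p q assume pq: "p \<in> ?I" "q \<in> ?I"
    obtain i e j f where ij: "p = (i, e)" "q = (j, f)" by (cases p, cases q)
    \<comment> \<open>Outside the powers of \<open>r\<close>, adjacency modulo \<open>n\<close> is
      equality of \<open>Y\<close> indices, and distinct \<open>Y\<close> vertices are not
      adjacent.\<close>
    show "(coord p, coord q) \<in> parcs (power_graph ?G) \<longleftrightarrow>
        p \<noteq> q \<and> (b p = b q \<or> (b p, b q) \<in> parcs ?P)"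
      unfolding power_graph_arc_iff[OF pq] unfolding ij
      by (cases e; cases f)
        (simp_all only: b_simps vert_vert vert_Y vert_neq_Y vert_neq_Y[symmetric]
          Y_Y_notin_parcs cong_def prod.case bool.case parent_vertex.inject add_right_cancel simp_thms)
  qed (rule parcs_parent_graph_subset parent_graph_irrefl)+
qed

end
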